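(* For every $k>0$, $B^k_\infty<B^{k+1}_\infty$.
   Context: A ceer is an equivalence relation on $\mathbb N$ c.e. as a subset of $\mathbb N^2$; $R_1\leq R_2$ means there is a total computable $f$ with $xR_1y\Leftrightarrow f(x)R_2f(y)$; $R_1<R_2$ means $R_1\leq R_2$ and $R_2\not\leq R_1$. A ceer is $k$-bounded if each class has at most $k$ elements. With $W_e$ the c.e. sets and $\langle\cdot,\cdot\rangle$ a computable pairing, $B^k_e$ is obtained from the enumeration of the equivalence relation generated by $\{(x,y):\langle x,y\rangle\in W_e\}$ by omitting any enumerated pair that would create a class of size $>k$ (so $\{B^k_e\}_e$ enumerates exactly the $k$-bounded ceers), and $B^k_\infty$ is defined by $\langle x,z\rangle B^k_\infty\langle y,z\rangle\Leftrightarrow xB^k_zy$, no other distinct pairs being related. $B^k_\infty$ is $k$-bounded and every $k$-bounded ceer reduces to it. *)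

theory Defs
  imports Main "HOL-Library.Nat_Bijection"
begin

section \<open>Partial computable functions\<close>

text \<open>
  Partial recursive functions, presented as unary functions on the natural numbers;
  several arguments are passed through Cantor's pairing function \<open>prod_encode\<close>, whose
  projections and whose lifting to functions are among the basic operations.
\<close>

datatype recfun =
    Zero
  | Succ
  | Fst
  | Snd
  | Pairing recfun recfun
  | Comp recfun recfun
  | Prec recfun recfun
  | Mu recfun

text \<open>
  \<open>computes c x y t\<close>: on input \<open>x\<close> the program \<open>c\<close> halts with output \<open>y\<close> after exactly \<open>t\<close>
  steps. Steps are the transitions of a machine with a stack of pending continuations: one for
  entering a program, and one more for each return of a subprogram that is not a tail call.

  \<open>Prec f g\<close> maps \<open>(a, m)\<close> to \<open>h m\<close>, where \<open>h 0 = f a\<close> and \<open>h (Suc m) = g (a, (m, h m))\<close>.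
  \<open>Mu f\<close> maps \<open>(a, m)\<close> to the least \<open>m' \<ge> m\<close> with \<open>f (a, m') = 0\<close>, provided that \<open>f\<close> is
  defined on all \<open>(a, i)\<close> with \<open>m \<le> i \<le> m'\<close>; the usual minimisation is the case \<open>m = 0\<close>.
\<close>

inductive computes :: "recfun \<Rightarrow> nat \<Rightarrow> nat \<Rightarrow> nat \<Rightarrow> bool" where
  Zero: "computes Zero x 0 1"
| Succ: "computes Succ x (Suc x) 1"
| Fst: "computes Fst x (fst (prod_decode x)) 1"
| Snd: "computes Snd x (snd (prod_decode x)) 1"
| Pairing: "\<lbrakk>computes f x y t; computes g x z u\<rbrakk>
    \<Longrightarrow> computes (Pairing f g) x (prod_encode (y, z)) (t + u + 3)"
| Comp: "\<lbrakk>computes g x y t; computes f y z u\<rbrakk> \<Longrightarrow> computes (Comp f g) x z (t + u + 2)"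
| Prec_0: "computes f a y t \<Longrightarrow> computes (Prec f g) (prod_encode (a, 0)) y (t + 1)"
| Prec_Suc: "\<lbrakk>computes (Prec f g) (prod_encode (a, m)) y t;
      computes g (prod_encode (a, prod_encode (m, y))) z u\<rbrakk>
    \<Longrightarrow> computes (Prec f g) (prod_encode (a, Suc m)) z (t + u + 2)"
| Mu_0: "computes f (prod_encode (a, m)) 0 t \<Longrightarrow> computes (Mu f) (prod_encode (a, m)) m (t + 2)"
| Mu_Suc: "\<lbrakk>computes f (prod_encode (a, m)) (Suc y) t;
      computes (Mu f) (prod_encode (a, Suc m)) z u\<rbrakk>
    \<Longrightarrow> computes (Mu f) (prod_encode (a, m)) z (t + u + 2)"

lemma computes_deterministic:
  "computes c x y t \<Longrightarrow> computes c x y' t' \<Longrightarrow> y' = y \<and> t' = t"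
proof (induction c x y t arbitrary: y' t' rule: computes.induct)
  case (Pairing f x y t g z u)
  from Pairing.prems show ?case
    by cases (use Pairing.IH in blast)
next
  case (Comp g x y t f z u)
  from Comp.prems show ?case
    by cases (use Comp.IH in blast)
next
  case (Prec_0 f a y t g)
  from Prec_0.prems show ?case
    by cases (use Prec_0.IH in auto)
next
  case (Prec_Suc f g a m y t z u)
  from Prec_Suc.prems show ?case
    by cases (use Prec_Suc.IH in auto)
next
  case (Mu_0 f a m t)
  from Mu_0.prems show ?case
    by cases (use Mu_0.IH in auto)
next
  case (Mu_Suc f a m y t z u)
  from Mu_Suc.prems show ?case
    by cases (use Mu_Suc.IH in auto)
qed (auto elim: computes.cases)

definition computable :: "(nat \<Rightarrow> nat) \<Rightarrow> bool" where
  "computable f \<longleftrightarrow> (\<exists>c. \<forall>x. \<exists>t. computes c x (f x) t)"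


section \<open>Computably enumerable sets\<close>

lemma component_less:
  fixes e :: nat
  assumes "e \<noteq> 0"
  shows "e div 4 - 1 < e"
    "fst (prod_decode (e div 4 - 1)) < e" "snd (prod_decode (e div 4 - 1)) < e"
proof -
  have *: "fst (prod_decode d) \<le> d" "snd (prod_decode d) \<le> d" for d
    by (metis le_prod_encode_1 le_prod_encode_2 prod.collapse prod_decode_inverse)+
  show less: "e div 4 - 1 < e"
    using assms by simp
  show "fst (prod_decode (e div 4 - 1)) < e" "snd (prod_decode (e div 4 - 1)) < e"
    by (rule le_less_trans[OF *(1) less], rule le_less_trans[OF *(2) less])
qed

text \<open>An effective numbering of all programs.\<close>

function program :: "nat \<Rightarrow> recfun" where
  "program e =
    (if e = 0 then Zero
     else if e = 1 then Succ
     else if e = 2 then Fst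
     else if e = 3 then Snd
     else
       (let d = e div 4 - 1; i = fst (prod_decode d); j = snd (prod_decode d) in
        if e mod 4 = 0 then Pairing (program i) (program j)
        else if e mod 4 = 1 then Comp (program i) (program j)
        else if e mod 4 = 2 then Prec (program i) (program j)
        else Mu (program d)))"
  by auto

termination
  by (relation "measure id")
    (rule wf_measure | simp only: in_measure id_apply, erule component_less)+

declare program.simps [simp del]

lemma program_simps:
  "program 0 = Zero"
  "program 1 = Succ"
  "program 2 = Fst"
  "program 3 = Snd"
  "program (4 * prod_encode (i, j) + 4) = Pairing (program i) (program j)"
  "program (4 * prod_encode (i, j) + 5) = Comp (program i) (program j)"
  "program (4 * prod_encode (i, j) + 6) = Prec (program i) (program j)"
  "program (4 * d + 7) = Mu (program d)"
proof -
  have *: "(4 * d + 4) div 4 - 1 = d" "(4 * d + 5) div 4 - 1 = d" "(4 * d + 6) div 4 - 1 = d"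
    "(4 * d + 7) div 4 - 1 = d" "(4 * d + 4) mod 4 = 0" "(4 * d + 5) mod 4 = 1"
    "(4 * d + 6) mod 4 = 2" "(4 * d + 7) mod 4 = 3" for d :: nat
    by presburger+
  show "program 0 = Zero" "program 1 = Succ" "program 2 = Fst" "program 3 = Snd"
    by (simp_all add: program.simps)
  show "program (4 * prod_encode (i, j) + 4) = Pairing (program i) (program j)"
    by (subst program.simps) (simp only: *, simp)
  show "program (4 * prod_encode (i, j) + 5) = Comp (program i) (program j)"
    by (subst program.simps) (simp only: *, simp)
  show "program (4 * prod_encode (i, j) + 6) = Prec (program i) (program j)"
    by (subst program.simps) (simp only: *, simp)
  show "program (4 * d + 7) = Mu (program d)"
    by (subst program.simps) (simp only: *, simp)
qed

lemma surj_program: "surj program"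
proof -
  have "\<exists>e. program e = c" for c
    by (induction c) (metis program_simps)+
  then show ?thesis
    by (metis surjI)
qed

definition ce_set :: "nat \<Rightarrow> nat set" where
  "ce_set e = {x. \<exists>y t. computes (program e) x y t}"

definition ce_set_stage :: "nat \<Rightarrow> nat \<Rightarrow> nat set" where
  "ce_set_stage e s = {x. x < s \<and> (\<exists>y. \<exists>t\<le>s. computes (program e) x y t)}"

definition ce :: "nat set \<Rightarrow> bool" where
  "ce A \<longleftrightarrow> (\<exists>e. A = ce_set e)"

lemma ce_set_stage_mono: "s \<le> s' \<Longrightarrow> ce_set_stage e s \<subseteq> ce_set_stage e s'"
  unfolding ce_set_stage_def by (auto intro: order_trans less_le_trans)

lemma finite_ce_set_stage: "finite (ce_set_stage e s)"
  unfolding ce_set_stage_def by simp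

lemma ce_set_eq_Union_stage: "ce_set e = (\<Union>s. ce_set_stage e s)"
proof (intro equalityI subsetI)
  fix x assume "x \<in> ce_set e"
  then obtain y t where "computes (program e) x y t"
    unfolding ce_set_def by blast
  then have "x \<in> ce_set_stage e (max (Suc x) t)"
    unfolding ce_set_stage_def by (auto simp: less_max_iff_disj intro: max.cobounded2)
  then show "x \<in> (\<Union>s. ce_set_stage e s)"
    by blast
qed (auto simp: ce_set_def ce_set_stage_def)


section \<open>Ceers and reducibility\<close>

definition ceer :: "nat rel \<Rightarrow> bool" where
  "ceer R \<longleftrightarrow> equiv UNIV R \<and> ce (prod_encode ` R)"

definition reducible :: "nat rel \<Rightarrow> nat rel \<Rightarrow> bool" (infix "\<le>\<^sub>c" 50) where
  "R \<le>\<^sub>c S \<longleftrightarrow> (\<exists>f. computable f \<and> (\<forall>x y. (x, y) \<in> R \<longleftrightarrow> (f x, f y) \<in> S))"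

definition strictly_reducible :: "nat rel \<Rightarrow> nat rel \<Rightarrow> bool" (infix "<\<^sub>c" 50) where
  "R <\<^sub>c S \<longleftrightarrow> R \<le>\<^sub>c S \<and> \<not> S \<le>\<^sub>c R"

definition k_bounded :: "nat \<Rightarrow> nat rel \<Rightarrow> bool" where
  "k_bounded k R \<longleftrightarrow> (\<forall>x. finite (R `` {x}) \<and> card (R `` {x}) \<le> k)"

definition equiv_closure :: "nat rel \<Rightarrow> nat rel" where
  "equiv_closure R = (R \<union> R\<inverse>)\<^sup>*"


section \<open>The enumeration of the bounded ceers\<close>

definition ceer_stage :: "nat \<Rightarrow> nat \<Rightarrow> nat rel" where
  "ceer_stage e s = equiv_closure {(x, y). prod_encode (x, y) \<in> ce_set_stage e s}"

text \<open>
  The equivalence relation \<open>\<Union>s. ceer_stage e s\<close> generated by the pairs coded in \<open>ce_set e\<close> is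
  enumerated by dovetailing: at step \<open>s = prod_encode (prod_encode (x, y), t)\<close> the pair
  \<open>(x, y)\<close> is enumerated if it belongs to the stage \<open>t\<close> approximation. Every pair recurs
  infinitely often; this does no harm, since classes only grow, so that a pair which has been
  omitted once is omitted at all later steps.
\<close>

primrec B_stage :: "nat \<Rightarrow> nat \<Rightarrow> nat \<Rightarrow> nat rel" where
  "B_stage k e 0 = Id"
| "B_stage k e (Suc s) =
    (let (p, t) = prod_decode s;
         R = equiv_closure (insert (prod_decode p) (B_stage k e s))
     in if prod_decode p \<in> ceer_stage e t \<and> k_bounded k R then R else B_stage k e s)"

definition B_ceer :: "nat \<Rightarrow> nat \<Rightarrow> nat rel" where
  "B_ceer k e = (\<Union>s. B_stage k e s)"

definition B_inf :: "nat \<Rightarrow> nat rel" where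
  "B_inf k = {(prod_encode (x, z), prod_encode (y, z)) | x y z. (x, y) \<in> B_ceer k z}"


section \<open>\<open>B_ceer k\<close> enumerates \<open>k\<close>-bounded equivalence relations, among them every \<open>k\<close>-bounded ceer\<close>

lemma equiv_equiv_closure: "equiv UNIV (equiv_closure R)"
  unfolding equiv_closure_def
  by (intro equivI refl_rtrancl sym_rtrancl sym_Un_converse trans_rtrancl) simp

lemma subset_equiv_closure: "R \<subseteq> equiv_closure R"
  unfolding equiv_closure_def by auto

lemma equiv_closure_least:
  assumes "equiv UNIV E" "R \<subseteq> E"
  shows "equiv_closure R \<subseteq> E"
proof
  fix p assume "p \<in> equiv_closure R"
  moreover have "R \<union> R\<inverse> \<subseteq> E"
    using assms by (auto simp: equiv_def dest: symD)
  moreover have "(a, b) \<in> E" if "(a, b) \<in> (R \<union> R\<inverse>)\<^sup>*" "R \<union> R\<inverse> \<subseteq> E" for a b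
    using that
  proof (induction rule: rtrancl_induct)
    case base
    show ?case
      using assms(1) by (simp add: equiv_def refl_on_def)
  next
    case (step y z)
    then show ?case
      using assms(1) by (meson equivE subsetD transD)
  qed
  ultimately show "p \<in> E"
    unfolding equiv_closure_def by (cases p) auto
qed

lemma equiv_closure_mono: "R \<subseteq> S \<Longrightarrow> equiv_closure R \<subseteq> equiv_closure S"
  by (meson equiv_closure_least equiv_equiv_closure order_trans subset_equiv_closure)

lemma equiv_B_stage: "equiv UNIV (B_stage k e s)"
proof (induction s)
  case 0
  show ?case by (auto intro!: equivI refl_onI symI transI)
next
  case (Suc s)
  then show ?case
    by (simp add: Let_def split_def equiv_equiv_closure)
qed

lemma k_bounded_B_stage: "k > 0 \<Longrightarrow> k_bounded k (B_stage k e s)"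
proof (induction s)
  case 0
  then show ?case by (simp add: k_bounded_def)
next
  case (Suc s)
  then show ?case
    by (simp add: Let_def split_def)
qed

lemma B_stage_mono: "s \<le> s' \<Longrightarrow> B_stage k e s \<subseteq> B_stage k e s'"
proof (induction rule: dec_induct)
  case (step n)
  have "B_stage k e n \<subseteq> B_stage k e (Suc n)"
    using subset_equiv_closure[of "insert _ (B_stage k e n)"]
    by (auto simp: Let_def split_def)
  then show ?case using step.IH by blast
qed simp

lemma equiv_B_ceer: "equiv UNIV (B_ceer k e)"
proof (intro equivI refl_onI symI transI)
  show "B_ceer k e \<subseteq> UNIV \<times> UNIV" by simp
  fix x y z
  show "(x, x) \<in> B_ceer k e"
    unfolding B_ceer_def using B_stage.simps(1) by blast
  show "(y, x) \<in> B_ceer k e" if "(x, y) \<in> B_ceer k e"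
    using that equiv_B_stage[of k e] unfolding B_ceer_def by (auto simp: equiv_def dest: symD)
  show "(x, z) \<in> B_ceer k e" if "(x, y) \<in> B_ceer k e" "(y, z) \<in> B_ceer k e"
  proof -
    from that obtain s s' where "(x, y) \<in> B_stage k e s" "(y, z) \<in> B_stage k e s'"
      unfolding B_ceer_def by blast
    then have "(x, y) \<in> B_stage k e (max s s')" "(y, z) \<in> B_stage k e (max s s')"
      using B_stage_mono[of s "max s s'" k e] B_stage_mono[of s' "max s s'" k e] by auto
    then have "(x, z) \<in> B_stage k e (max s s')"
      using equiv_B_stage[of k e "max s s'"] by (auto simp: equiv_def dest: transD)
    then show ?thesis
      unfolding B_ceer_def by blast
  qed
qed

lemma k_bounded_B_ceer:
  assumes "k > 0"
  shows "k_bounded k (B_ceer k e)"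
  unfolding k_bounded_def
proof (rule allI, rule ccontr)
  fix x
  assume *: "\<not> (finite (B_ceer k e `` {x}) \<and> card (B_ceer k e `` {x}) \<le> k)"
  have "\<exists>A \<subseteq> B_ceer k e `` {x}. finite A \<and> card A = Suc k"
  proof (cases "finite (B_ceer k e `` {x})")
    case True
    with * have "Suc k \<le> card (B_ceer k e `` {x})" by simp
    then show ?thesis by (metis obtain_subset_with_card_n)
  next
    case False
    then show ?thesis by (meson infinite_arbitrarily_large)
  qed
  then obtain A where A: "A \<subseteq> B_ceer k e `` {x}" "finite A" "card A = Suc k"
    by blast
  have "\<exists>s. A' \<subseteq> B_stage k e s `` {x}" if "finite A'" "A' \<subseteq> A" for A'
    using that
  proof (induction rule: finite_induct)
    case (insert y F)
    then obtain s where s: "F \<subseteq> B_stage k e s `` {x}" by auto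
    from insert A(1) obtain s' where s': "(x, y) \<in> B_stage k e s'"
      unfolding B_ceer_def by blast
    have "insert y F \<subseteq> B_stage k e (max s s') `` {x}"
      using s s' B_stage_mono[of s "max s s'" k e] B_stage_mono[of s' "max s s'" k e] by auto
    then show ?case by blast
  qed simp
  then obtain s where "A \<subseteq> B_stage k e s `` {x}"
    using A(2) by blast
  moreover have "finite (B_stage k e s `` {x})" "card (B_stage k e s `` {x}) \<le> k"
    using k_bounded_B_stage[OF assms] by (simp_all add: k_bounded_def)
  ultimately show False
    using A(3) card_mono by (metis Suc_n_not_le_n order_trans)
qed

lemma k_bounded_subset:
  assumes "k_bounded k S" "R \<subseteq> S"
  shows "k_bounded k R"
  unfolding k_bounded_def
proof
  fix x
  have "R `` {x} \<subseteq> S `` {x}" "finite (S `` {x})" "card (S `` {x}) \<le> k"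
    using assms by (auto simp: k_bounded_def)
  then show "finite (R `` {x}) \<and> card (R `` {x}) \<le> k"
    by (meson card_mono finite_subset order_trans)
qed

lemma B_ceer_exhaustive:
  assumes "ceer R" "k_bounded k R"
  shows "\<exists>e. B_ceer k e = R"
proof -
  from assms(1) obtain e where e: "prod_encode ` R = ce_set e" and R: "equiv UNIV R"
    by (auto simp: ceer_def ce_def)
  have in_e: "prod_encode p \<in> ce_set e \<longleftrightarrow> p \<in> R" for p
    unfolding e[symmetric] by (auto simp: inj_image_mem_iff inj_prod_encode)
  have stage: "ceer_stage e t \<subseteq> R" for t
    unfolding ceer_stage_def
    by (rule equiv_closure_least[OF R]) (use in_e ce_set_eq_Union_stage in blast)
  have sub: "B_stage k e s \<subseteq> R" for s
  proof (induction s)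
    case 0
    show ?case using R by (auto simp: equiv_def refl_on_def)
  next
    case (Suc s)
    have "equiv_closure (insert p (B_stage k e s)) \<subseteq> R" if "p \<in> ceer_stage e t" for p t
      using that stage Suc.IH by (intro equiv_closure_least[OF R]) auto
    then show ?case
      using Suc.IH by (simp add: Let_def split_def) blast
  qed
  moreover have "R \<subseteq> B_ceer k e"
  proof
    fix p assume "p \<in> R"
    then obtain t where "prod_encode p \<in> ce_set_stage e t"
      using in_e ce_set_eq_Union_stage by blast
    then have p: "p \<in> ceer_stage e t"
      unfolding ceer_stage_def by (intro subsetD[OF subset_equiv_closure]) (cases p, simp)
    define s where "s = prod_encode (prod_encode p, t)"
    have "equiv_closure (insert p (B_stage k e s)) \<subseteq> R"
      using \<open>p \<in> R\<close> sub by (intro equiv_closure_least[OF R]) auto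
    with p have "B_stage k e (Suc s) = equiv_closure (insert p (B_stage k e s))"
      using assms(2) k_bounded_subset by (auto simp: s_def)
    then have "p \<in> B_stage k e (Suc s)"
      using subset_equiv_closure by blast
    then show "p \<in> B_ceer k e"
      unfolding B_ceer_def by blast
  qed
  ultimately show ?thesis
    unfolding B_ceer_def by blast
qed

end

theory Submission
  imports Defs
begin

text \<open>
  Simulating programs step by step decides every stage of \<open>B_ceer k z\<close> uniformly in \<open>z\<close>, so
  \<open>B_inf k\<close> is itself a \<open>k\<close>-bounded ceer and hence occurs among the \<open>B_ceer (k + 1) e\<close>; a fixed
  such \<open>e\<close> yields the reduction \<open>n \<mapsto> \<langle>n, e\<rangle>\<close>. For strictness, reserve \<open>k + 1\<close> numbers for each
  program and collapse them as soon as the program has converged on all of them with pairwise distinct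
  outputs. If it computed a reduction to a \<open>k\<close>-bounded relation, it could not identify two of them
  before the collapse, and afterwards it would map them to \<open>k + 1\<close> distinct equivalent numbers. So
  this \<open>(k + 1)\<close>-bounded ceer, which reduces to \<open>B_inf (k + 1)\<close>, does not reduce to \<open>B_inf k\<close>.
\<close>


section \<open>Closure properties of the computable functions\<close>

abbreviation pfst :: "nat \<Rightarrow> nat" where
  "pfst n \<equiv> fst (prod_decode n)"

abbreviation psnd :: "nat \<Rightarrow> nat" where
  "psnd n \<equiv> snd (prod_decode n)"

named_theorems computable_intros

lemma pfst_le: "pfst n \<le> n"
  by (metis le_prod_encode_1 prod.collapse prod_decode_inverse)

lemma psnd_le: "psnd n \<le> n"
  by (metis le_prod_encode_2 prod.collapse prod_decode_inverse)

lemma computable_id [computable_intros]: "computable (\<lambda>x. x)"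
  unfolding computable_def
proof (intro exI allI)
  fix x
  \<comment> \<open>The identity is not basic; it is rebuilt from the two projections because
    \<open>prod_encode\<close> is onto.\<close>
  show "computes (Pairing Fst Snd) x x (1 + 1 + 3)"
    using computes.Pairing[OF computes.Fst[of x] computes.Snd[of x]] by simp
qed

text \<open>Not among \<open>computable_intros\<close>: its conclusion unifies with every goal, so
  each use names the function to be composed.\<close>

lemma computable_compose:
  assumes "computable f" "computable g"
  shows "computable (\<lambda>x. f (g x))"
  using assms computes.Comp unfolding computable_def by metis

lemma computable_Suc [computable_intros]:
  "computable f \<Longrightarrow> computable (\<lambda>x. Suc (f x))"
  by (rule computable_compose) (auto simp: computable_def intro: computes.Succ)

lemma computable_const [computable_intros]: "computable (\<lambda>_. n)"
proof (induction n)
  case 0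
  show ?case
    by (auto simp: computable_def intro: computes.Zero)
qed (rule computable_Suc)

lemma computable_pfst [computable_intros]:
  "computable f \<Longrightarrow> computable (\<lambda>x. pfst (f x))"
  by (rule computable_compose) (auto simp: computable_def intro: computes.Fst)

lemma computable_psnd [computable_intros]:
  "computable f \<Longrightarrow> computable (\<lambda>x. psnd (f x))"
  by (rule computable_compose) (auto simp: computable_def intro: computes.Snd)

lemma computable_prod_encode [computable_intros]:
  assumes "computable f" "computable g"
  shows "computable (\<lambda>x. prod_encode (f x, g x))"
  using assms computes.Pairing unfolding computable_def by metis

lemma computable_compose2:
  assumes "computable (\<lambda>p. F (pfst p) (psnd p))" "computable f" "computable g"
  shows "computable (\<lambda>x. F (f x) (g x))"
  using computable_compose[OF assms(1) computable_prod_encode[OF assms(2,3)]] by simp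

text \<open>This is \<open>Prec\<close> with \<open>x\<close> as parameter. Later functions are
  written as \<open>rec_nat\<close> terms so that this rule yields their computability.\<close>

lemma computable_rec_nat [computable_intros]:
  assumes "computable F" "computable (\<lambda>p. G (pfst p) (pfst (psnd p)) (psnd (psnd p)))"
    "computable N"
  shows "computable (\<lambda>x. rec_nat (F x) (G x) (N x))"
proof -
  from assms obtain f g where f: "\<And>x. \<exists>t. computes f x (F x) t"
    and g: "\<And>p. \<exists>t. computes g p (G (pfst p) (pfst (psnd p)) (psnd (psnd p))) t"
    unfolding computable_def by metis
  have "\<exists>t. computes (Prec f g) (prod_encode (a, m)) (rec_nat (F a) (G a) m) t" for a m
  proof (induction m)
    case 0
    show ?case using f computes.Prec_0 by (metis old.nat.simps(6))
  next
    case (Suc m)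
    then obtain t where "computes (Prec f g) (prod_encode (a, m)) (rec_nat (F a) (G a) m) t"
      by blast
    moreover obtain u where "computes g (prod_encode (a, prod_encode (m, rec_nat (F a) (G a) m)))
        (rec_nat (F a) (G a) (Suc m)) u"
      using g[of "prod_encode (a, prod_encode (m, rec_nat (F a) (G a) m))"] by auto
    ultimately show ?case using computes.Prec_Suc by blast
  qed
  then have "computable (\<lambda>p. rec_nat (F (pfst p)) (G (pfst p)) (psnd p))"
    unfolding computable_def by (metis prod.collapse prod_decode_inverse)
  from computable_compose2[OF this computable_id assms(3)] show ?thesis .
qed

section \<open>Case distinction and decidable predicates\<close>

lemma computable_if_0:
  assumes "computable c" "computable f" "computable g"
  shows "computable (\<lambda>x. if c x = 0 then f x else g x)"
proof -
  have "computable (\<lambda>x. rec_nat (f x) (\<lambda>_ _. g x) (c x))"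
    \<comment> \<open>In the step function the argument is a triple with \<open>x\<close> as first
      component, so \<open>g\<close> is composed with \<open>pfst\<close> there.\<close>
    by (intro computable_intros assms computable_compose[OF assms(3)])
  moreover have "rec_nat (f x) (\<lambda>_ _. g x) (c x) = (if c x = 0 then f x else g x)" for x
    by (cases "c x") auto
  ultimately show ?thesis by simp
qed

text \<open>Truth is coded by \<open>0\<close>, the value for which \<open>Mu\<close>
  searches.\<close>

definition decidable :: "(nat \<Rightarrow> bool) \<Rightarrow> bool" where
  "decidable P \<longleftrightarrow> computable (\<lambda>x. if P x then 0 else 1)"

lemma decidable_compose:
  assumes "decidable P" "computable f"
  shows "decidable (\<lambda>x. P (f x))"
  using computable_compose[OF assms(1)[unfolded decidable_def] assms(2)]
  unfolding decidable_def .

lemma computable_if [computable_intros]: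
  assumes "decidable P" "computable f" "computable g"
  shows "computable (\<lambda>x. if P x then f x else g x)"
proof -
  have "(if (if P x then 0 else 1) = (0::nat) then f x else g x) = (if P x then f x else g x)" for x
    by simp
  then show ?thesis
    using computable_if_0[OF assms(1)[unfolded decidable_def] assms(2,3)] by simp
qed

lemma decidable_not [computable_intros]:
  assumes "decidable P"
  shows "decidable (\<lambda>x. \<not> P x)"
proof -
  have "(if \<not> P x then 0 else 1) = (if P x then 1 else (0::nat))" for x
    by simp
  moreover have "computable (\<lambda>x. if P x then 1 else 0)"
    by (intro computable_intros assms)
  ultimately show ?thesis by (simp add: decidable_def)
qed

lemma decidable_conj [computable_intros]:
  assumes "decidable P" "decidable Q"
  shows "decidable (\<lambda>x. P x \<and> Q x)"
proof -
  have "(if P x \<and> Q x then 0 else 1) = (if P x then if Q x then 0 else 1 else (1::nat))" for x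
    by simp
  moreover have "computable (\<lambda>x. if P x then if Q x then 0 else 1 else 1)"
    by (intro computable_intros assms)
  ultimately show ?thesis by (simp add: decidable_def)
qed

lemma decidable_disj [computable_intros]:
  assumes "decidable P" "decidable Q"
  shows "decidable (\<lambda>x. P x \<or> Q x)"
  using decidable_not[OF decidable_conj[OF decidable_not[OF assms(1)] decidable_not[OF assms(2)]]]
  by simp

lemma decidable_imp [computable_intros]:
  assumes "decidable P" "decidable Q"
  shows "decidable (\<lambda>x. P x \<longrightarrow> Q x)"
  using decidable_disj[OF decidable_not[OF assms(1)] assms(2)] by simp

section \<open>Arithmetic and comparisons\<close>

lemma computable_diff [computable_intros]:
  assumes "computable f" "computable g"
  shows "computable (\<lambda>x. f x - g x)"
proof -
  have pred: "computable (\<lambda>x. h x - 1)" if "computable h" for h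
  proof -
    \<comment> \<open>The predecessor is a recursion that returns its own index; iterating it gives
      truncated subtraction.\<close>
    have "computable (\<lambda>x. rec_nat 0 (\<lambda>m _. m) (h x))"
      by (intro computable_intros that)
    moreover have "rec_nat 0 (\<lambda>m _. m) n = n - 1" for n :: nat
      by (cases n) auto
    ultimately show ?thesis by simp
  qed
  have "computable (\<lambda>x. rec_nat (f x) (\<lambda>_ h. h - 1) (g x))"
    by (intro computable_intros assms pred)
  moreover have "rec_nat a (\<lambda>_ h. h - 1) n = a - n" for a n :: nat
    by (induction n) auto
  ultimately show ?thesis by simp
qed

lemma decidable_le [computable_intros]:
  assumes "computable f" "computable g"
  shows "decidable (\<lambda>x. f x \<le> g x)"
  using computable_if_0[OF computable_diff[OF assms] computable_const[of 0] computable_const[of 1]]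
  by (simp add: decidable_def)

lemma decidable_less [computable_intros]:
  assumes "computable f" "computable g"
  shows "decidable (\<lambda>x. f x < g x)"
  using decidable_le[OF computable_Suc[OF assms(1)] assms(2)] by (simp add: Suc_le_eq)

lemma decidable_eq [computable_intros]:
  assumes "computable f" "computable g"
  shows "decidable (\<lambda>x. f x = g x)"
  using decidable_conj[OF decidable_le[OF assms] decidable_le[OF assms(2,1)]]
  by (simp add: order_eq_iff)

lemma computable_add [computable_intros]:
  assumes "computable f" "computable g"
  shows "computable (\<lambda>x. f x + g x)"
proof -
  have "computable (\<lambda>x. rec_nat (f x) (\<lambda>_ h. Suc h) (g x))"
    by (intro computable_intros assms)
  moreover have "rec_nat a (\<lambda>_ h. Suc h) n = a + n" for a n
    by (induction n) auto
  ultimately show ?thesis by simp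
qed

lemma computable_power2 [computable_intros]:
  assumes "computable f"
  shows "computable (\<lambda>x. 2 ^ f x)"
proof -
  have "computable (\<lambda>x. rec_nat 1 (\<lambda>_ h. h + h) (f x))"
    by (intro computable_intros assms)
  moreover have "rec_nat 1 (\<lambda>_ h. h + h) n = (2::nat) ^ n" for n
    by (induction n) auto
  ultimately show ?thesis by simp
qed

text \<open>A counter that is reset on reaching the modulus. With modulus \<open>0\<close> it is
  never reset, in agreement with \<open>a mod 0 = a\<close>.\<close>

lemma computable_mod [computable_intros]:
  assumes "computable f" "computable g"
  shows "computable (\<lambda>x. f x mod g x)"
proof -
  have "computable (\<lambda>x. rec_nat 0 (\<lambda>_ h. if Suc h = g x then 0 else Suc h) (f x))"
    by (intro computable_intros assms computable_compose[OF assms(2)])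
  moreover have "rec_nat 0 (\<lambda>_ h. if Suc h = b then 0 else Suc h) a = a mod b" for a b
    by (induction a) (auto simp: mod_Suc)
  ultimately show ?thesis by simp
qed

text \<open>The quotient grows exactly when the counter of the remainder is reset; with divisor
  \<open>0\<close> it stays \<open>0\<close>, as \<open>a div 0\<close> does.\<close>

lemma computable_div [computable_intros]:
  assumes "computable f" "computable g"
  shows "computable (\<lambda>x. f x div g x)"
proof -
  have "computable (\<lambda>x. rec_nat 0 (\<lambda>m h. if Suc (m mod g x) = g x then Suc h else h) (f x))"
    by (intro computable_intros assms computable_compose[OF assms(2)])
  moreover have "rec_nat 0 (\<lambda>m h. if Suc (m mod b) = b then Suc h else h) a = a div b" for a b
    by (induction a) (auto simp: div_Suc mod_Suc)
  ultimately show ?thesis by simp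
qed

lemma decidable_odd [computable_intros]:
  assumes "computable f"
  shows "decidable (\<lambda>x. odd (f x))"
proof -
  have "decidable (\<lambda>x. f x mod 2 = 1)"
    by (intro computable_intros assms)
  then show ?thesis by (simp add: odd_iff_mod_2_eq_one)
qed

section \<open>Bounded quantifiers, counting and finite sets\<close>

lemma decidable_all_less [computable_intros]:
  assumes "decidable (\<lambda>p. P (pfst p) (psnd p))" "computable N"
  shows "decidable (\<lambda>x. \<forall>i<N x. P x i)"
proof -
  have "computable (\<lambda>x. rec_nat 0 (\<lambda>i h. if P x i then h else 1) (N x))"
    \<comment> \<open>The step function receives \<open>(x, (i, h))\<close>, while the predicate
      expects \<open>(x, i)\<close>; the composition repacks the argument.\<close>
    by (intro computable_intros assms
        decidable_compose[OF assms(1), of "\<lambda>p. prod_encode (pfst p, pfst (psnd p))", simplified])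
  moreover have "rec_nat 0 (\<lambda>i h. if P x i then h else 1) n = (if \<forall>i<n. P x i then 0 else (1::nat))"
    for x n by (induction n) (auto simp: less_Suc_eq)
  ultimately show ?thesis by (simp add: decidable_def)
qed

lemma computable_card [computable_intros]:
  assumes "decidable (\<lambda>p. P (pfst p) (psnd p))" "computable N"
  shows "computable (\<lambda>x. card {i. i < N x \<and> P x i})"
proof -
  have "computable (\<lambda>x. rec_nat 0 (\<lambda>i h. if P x i then Suc h else h) (N x))"
    by (intro computable_intros assms
        decidable_compose[OF assms(1), of "\<lambda>p. prod_encode (pfst p, pfst (psnd p))", simplified])
  moreover have "rec_nat 0 (\<lambda>i h. if P x i then Suc h else h) n = card {i. i < n \<and> P x i}" for x n
  proof (induction n)
    case (Suc n)
    have "{i. i < Suc n \<and> P x i} = (if P x n then insert n else id) {i. i < n \<and> P x i}"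
      by (auto simp: less_Suc_eq)
    with Suc show ?case by simp
  qed simp
  ultimately show ?thesis by simp
qed

text \<open>Adding up the powers \<open>2 ^ i\<close> builds the code of the set digit by digit.
  This is what makes \<open>merge\<close> computable.\<close>

lemma computable_set_encode [computable_intros]:
  assumes "decidable (\<lambda>p. P (pfst p) (psnd p))" "computable N"
  shows "computable (\<lambda>x. set_encode {i. i < N x \<and> P x i})"
proof -
  have "computable (\<lambda>x. rec_nat 0 (\<lambda>i h. if P x i then 2 ^ i + h else h) (N x))"
    by (intro computable_intros assms
        decidable_compose[OF assms(1), of "\<lambda>p. prod_encode (pfst p, pfst (psnd p))", simplified])
  moreover have "rec_nat 0 (\<lambda>i h. if P x i then 2 ^ i + h else h) n
      = set_encode {i. i < n \<and> P x i}" for x n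
  proof (induction n)
    case (Suc n)
    have "{i. i < Suc n \<and> P x i} = (if P x n then insert n else id) {i. i < n \<and> P x i}"
      by (auto simp: less_Suc_eq)
    with Suc show ?case by simp
  qed simp
  ultimately show ?thesis by simp
qed

text \<open>Unbounded search: \<open>Mu\<close>, applied to the characteristic function of
  \<open>P\<close>, halts exactly when a witness exists. Every proof below that a relation is c.e.
  goes through this form.\<close>

lemma ce_Ex:
  assumes "decidable (\<lambda>p. P (pfst p) (psnd p))"
  shows "ce {a. \<exists>s. P a s}"
proof -
  from assms obtain c
    where c: "\<And>p. \<exists>t. computes c p (if P (pfst p) (psnd p) then 0 else 1) t"
    unfolding decidable_def computable_def by blast
  \<comment> \<open>The starting point \<open>m\<close> is arbitrary because the search moves it
    upwards.\<close>
  have sound: "P a y" if "computes (Mu c) (prod_encode (a, m)) y t" for a m y t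
    using that
  proof (induction "Mu c" "prod_encode (a, m)" y t arbitrary: m rule: computes.induct)
    case (Mu_0 a' m' t)
    with c[of "prod_encode (a, m)"] show ?case
      by (auto dest: computes_deterministic split: if_splits)
  qed auto
  \<comment> \<open>Induction downwards from the witness \<open>s\<close>: at each \<open>n\<close>
    the search either stops at once or continues at \<open>Suc n\<close>, where it is already known
    to halt.\<close>
  have complete: "\<exists>y t. computes (Mu c) (prod_encode (a, m)) y t" if "m \<le> s" "P a s" for a m s
    using that(1)
  proof (induction rule: inc_induct)
    case base
    have "\<exists>t. computes c (prod_encode (a, s)) 0 t"
      using c[of "prod_encode (a, s)"] that(2) by simp
    then show ?case using computes.Mu_0 by blast
  next
    case (step n)
    show ?case
    proof (cases "P a n")
      case True
      then have "\<exists>t. computes c (prod_encode (a, n)) 0 t"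
        using c[of "prod_encode (a, n)"] by simp
      then show ?thesis using computes.Mu_0 by blast
    next
      case False
      then have "\<exists>t. computes c (prod_encode (a, n)) (Suc 0) t"
        using c[of "prod_encode (a, n)"] by simp
      then show ?thesis using step.IH computes.Mu_Suc by blast
    qed
  qed
  \<comment> \<open>\<open>d\<close> supplies the value \<open>0\<close> at which the search
    starts.\<close>
  obtain d where d: "\<And>a. \<exists>t. computes d a (prod_encode (a, 0)) t"
    using computable_prod_encode[OF computable_id computable_const[of 0]]
    unfolding computable_def by blast
  obtain e where e: "program e = Comp (Mu c) d"
    using surj_program by (metis surjD)
  have "a \<in> ce_set e \<longleftrightarrow> (\<exists>s. P a s)" for a
  proof
    assume "a \<in> ce_set e"
    then obtain y t where "computes (Comp (Mu c) d) a y t"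
      by (auto simp: ce_set_def e)
    then obtain b u v where "computes d a b u" "computes (Mu c) b y v"
      by (cases rule: computes.cases) auto
    moreover from this d have "b = prod_encode (a, 0)"
      using computes_deterministic by blast
    ultimately show "\<exists>s. P a s"
      using sound by blast
  next
    assume "\<exists>s. P a s"
    then obtain y t where "computes (Mu c) (prod_encode (a, 0)) y t"
      using complete by blast
    then show "a \<in> ce_set e"
      using d computes.Comp unfolding ce_set_def e by blast
  qed
  then show ?thesis
    unfolding ce_def by blast
qed


section \<open>A universal machine\<close>

text \<open>
  The machine behind the step counts of \<open>computes\<close>: a configuration either enters the program
  with index \<open>e\<close> on input \<open>x\<close>, or returns a value \<open>y\<close>, and \<open>K\<close> codes the stack of pending
  continuations. The empty stack is \<open>0\<close>; returning to it is the halting configuration, and a fixed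
  point of \<open>machine_step\<close>.
\<close>

definition enter :: "nat \<Rightarrow> nat \<Rightarrow> nat \<Rightarrow> nat" where
  "enter e x K = prod_encode (0, prod_encode (e, prod_encode (x, K)))"

definition return :: "nat \<Rightarrow> nat \<Rightarrow> nat" where
  "return y K = prod_encode (1, prod_encode (y, K))"

text \<open>\<open>Suc\<close> keeps nonempty stacks apart from \<open>0\<close>. Tags:
  \<open>0\<close> and \<open>1\<close> await the first and second component of a pair,
  \<open>2\<close> the inner value of a composition, \<open>3\<close> the previous value of a
  recursion, \<open>4\<close> the test value of a minimisation.\<close>

definition push :: "nat \<Rightarrow> nat \<Rightarrow> nat \<Rightarrow> nat" where
  "push tag a K = Suc (prod_encode (tag, prod_encode (a, K)))"

text \<open>The base case of \<open>Prec\<close> is a tail call and pushes nothing, which matches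
  its single extra step in \<open>computes\<close>. The frame of \<open>Mu\<close> stores
  \<open>e\<close> itself so that the search can be resumed.\<close>

definition enter_step :: "nat \<Rightarrow> nat \<Rightarrow> nat \<Rightarrow> nat" where
  "enter_step e x K =
    (let d = e div 4 - 1; i = pfst d; j = psnd d; a = pfst x; m = psnd x in
     if e = 0 then return 0 K
     else if e = 1 then return (Suc x) K
     else if e = 2 then return (pfst x) K
     else if e = 3 then return (psnd x) K
     else if e mod 4 = 0 then enter i x (push 0 (prod_encode (j, x)) K)
     else if e mod 4 = 1 then enter j x (push 2 i K)
     else if e mod 4 = 2 then
       (if m = 0 then enter i a K
        else enter e (prod_encode (a, m - 1)) (push 3 (prod_encode (j, prod_encode (a, m - 1))) K))
     else enter d x (push 4 (prod_encode (e, x)) K))"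

definition return_step :: "nat \<Rightarrow> nat \<Rightarrow> nat" where
  "return_step y K =
    (let tag = pfst (K - 1); a = pfst (psnd (K - 1)); K' = psnd (psnd (K - 1)) in
     if K = 0 then return y 0
     else if tag = 0 then enter (pfst a) (psnd a) (push 1 y K')
     else if tag = 1 then return (prod_encode (a, y)) K'
     else if tag = 2 then enter a y K'
     else if tag = 3 then
       enter (pfst a) (prod_encode (pfst (psnd a), prod_encode (psnd (psnd a), y))) K'
     else if y = 0 then return (psnd (psnd a)) K'
     else enter (pfst a) (prod_encode (pfst (psnd a), Suc (psnd (psnd a)))) K')"

definition machine_step :: "nat \<Rightarrow> nat" where
  "machine_step c =
    (let r = psnd c in
     if pfst c = 0 then enter_step (pfst r) (pfst (psnd r)) (psnd (psnd r))
     else return_step (pfst r) (psnd r))"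

lemma machine_step_enter [simp]: "machine_step (enter e x K) = enter_step e x K"
  by (simp add: machine_step_def enter_def)

lemma machine_step_return [simp]: "machine_step (return y K) = return_step y K"
  by (simp add: machine_step_def return_def)

lemma enter_step_simps:
  "enter_step 0 x K = return 0 K"
  "enter_step 1 x K = return (Suc x) K"
  "enter_step 2 x K = return (pfst x) K"
  "enter_step 3 x K = return (psnd x) K"
  "enter_step (4 * prod_encode (i, j) + 4) x K = enter i x (push 0 (prod_encode (j, x)) K)"
  "enter_step (4 * prod_encode (i, j) + 5) x K = enter j x (push 2 i K)"
  "enter_step (4 * prod_encode (i, j) + 6) (prod_encode (a, 0)) K = enter i a K"
  "enter_step (4 * prod_encode (i, j) + 6) (prod_encode (a, Suc m)) K =
    enter (4 * prod_encode (i, j) + 6) (prod_encode (a, m))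
      (push 3 (prod_encode (j, prod_encode (a, m))) K)"
  "enter_step (4 * d + 7) x K = enter d x (push 4 (prod_encode (4 * d + 7, x)) K)"
proof -
  have *: "(4 * d + 4) div 4 - 1 = d" "(4 * d + 5) div 4 - 1 = d" "(4 * d + 6) div 4 - 1 = d"
    "(4 * d + 7) div 4 - 1 = d" "(4 * d + 4) mod 4 = 0" "(4 * d + 5) mod 4 = 1"
    "(4 * d + 6) mod 4 = 2" "(4 * d + 7) mod 4 = 3" for d :: nat
    by presburger+
  show "enter_step 0 x K = return 0 K" "enter_step 1 x K = return (Suc x) K"
    "enter_step 2 x K = return (pfst x) K" "enter_step 3 x K = return (psnd x) K"
    by (simp_all add: enter_step_def)
  show "enter_step (4 * prod_encode (i, j) + 4) x K = enter i x (push 0 (prod_encode (j, x)) K)"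
    "enter_step (4 * prod_encode (i, j) + 5) x K = enter j x (push 2 i K)"
    "enter_step (4 * prod_encode (i, j) + 6) (prod_encode (a, 0)) K = enter i a K"
    "enter_step (4 * prod_encode (i, j) + 6) (prod_encode (a, Suc m)) K =
      enter (4 * prod_encode (i, j) + 6) (prod_encode (a, m))
        (push 3 (prod_encode (j, prod_encode (a, m))) K)"
    "enter_step (4 * d + 7) x K = enter d x (push 4 (prod_encode (4 * d + 7, x)) K)"
    unfolding enter_step_def Let_def * by simp_all
qed

lemma return_step_simps:
  "return_step y 0 = return y 0"
  "return_step y (push 0 (prod_encode (j, x)) K) = enter j x (push 1 y K)"
  "return_step y (push 1 z K) = return (prod_encode (z, y)) K"
  "return_step y (push 2 i K) = enter i y K"
  "return_step y (push 3 (prod_encode (j, prod_encode (a, m))) K) =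
    enter j (prod_encode (a, prod_encode (m, y))) K"
  "return_step 0 (push 4 (prod_encode (e, prod_encode (a, m))) K) = return m K"
  "return_step (Suc y) (push 4 (prod_encode (e, prod_encode (a, m))) K) =
    enter e (prod_encode (a, Suc m)) K"
  by (simp_all add: return_step_def push_def)

text \<open>Inverts the numbering once and for all, so that later arguments see only the shape of an
  index.\<close>

lemma program_cases:
  obtains "e = 0" "program e = Zero"
  | "e = 1" "program e = Succ"
  | "e = 2" "program e = Fst"
  | "e = 3" "program e = Snd"
  | i j where "e = 4 * prod_encode (i, j) + 4" "program e = Pairing (program i) (program j)"
  | i j where "e = 4 * prod_encode (i, j) + 5" "program e = Comp (program i) (program j)"
  | i j where "e = 4 * prod_encode (i, j) + 6" "program e = Prec (program i) (program j)"
  | d where "e = 4 * d + 7" "program e = Mu (program d)"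
proof -
  have "e = 0 \<or> e = 1 \<or> e = 2 \<or> e = 3 \<or>
    (\<exists>d. e = 4 * d + 4 \<or> e = 4 * d + 5 \<or> e = 4 * d + 6 \<or> e = 4 * d + 7)"
    by presburger
  moreover have "\<exists>i j. d = prod_encode (i, j)" for d
    by (metis prod.collapse prod_decode_inverse)
  ultimately show thesis
    using that program_simps by metis
qed

text \<open>Induction on the derivation. The stack must be arbitrary since subprograms run on top of
  further frames; the step counts agree exactly.\<close>

lemma machine_sound:
  "computes c x y t \<Longrightarrow> program e = c \<Longrightarrow> (machine_step ^^ t) (enter e x K) = return y K"
proof (induction c x y t arbitrary: e K rule: computes.induct)
  case (Pairing f x y t g z u)
  obtain i j where e: "e = 4 * prod_encode (i, j) + 4" "program i = f" "program j = g"
    using Pairing.prems by (cases e rule: program_cases) auto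
  \<comment> \<open>Read from right to left this is the order in time: enter, run \<open>f\<close>,
    switch to \<open>g\<close>, run \<open>g\<close>, form the pair. The sums in the other cases are
    split likewise.\<close>
  have "t + u + 3 = Suc (u + Suc (t + Suc 0))" by simp
  then show ?case
    by (simp only: funpow_add funpow.simps comp_apply)
      (simp add: e enter_step_simps return_step_simps Pairing.IH del: One_nat_def)
next
  case (Comp g x y t f z u)
  obtain i j where e: "e = 4 * prod_encode (i, j) + 5" "program i = f" "program j = g"
    using Comp.prems by (cases e rule: program_cases) auto
  have "t + u + 2 = u + Suc (t + 1)" by simp
  then show ?case
    by (simp only: funpow_add funpow.simps comp_apply)
      (simp add: e enter_step_simps return_step_simps Comp.IH)
next
  case (Prec_0 f a y t g)
  obtain i j where e: "e = 4 * prod_encode (i, j) + 6" "program i = f" "program j = g"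
    using Prec_0.prems by (cases e rule: program_cases) auto
  show ?case
    by (simp only: funpow_add funpow.simps comp_apply)
      (simp add: e enter_step_simps return_step_simps Prec_0.IH)
next
  case (Prec_Suc f g a m y t z u)
  obtain i j where e: "e = 4 * prod_encode (i, j) + 6" "program i = f" "program j = g"
    using Prec_Suc.prems by (cases e rule: program_cases) auto
  note IH = Prec_Suc.IH(1)[OF Prec_Suc.prems, unfolded e(1)] Prec_Suc.IH(2)[OF e(3)]
  have "t + u + 2 = u + Suc (t + 1)" by simp
  then show ?case
    by (simp only: funpow_add funpow.simps comp_apply)
      (simp add: e(1) enter_step_simps return_step_simps IH del: add_Suc_right)
next
  case (Mu_0 f a m t)
  obtain d where e: "e = 4 * d + 7" "program d = f"
    using Mu_0.prems by (cases e rule: program_cases) auto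
  have "t + 2 = Suc (t + 1)" by simp
  then show ?case
    by (simp only: funpow_add funpow.simps comp_apply)
      (simp add: e enter_step_simps return_step_simps Mu_0.IH)
next
  case (Mu_Suc f a m y t z u)
  obtain d where e: "e = 4 * d + 7" "program d = f"
    using Mu_Suc.prems by (cases e rule: program_cases) auto
  note IH = Mu_Suc.IH(1)[OF e(2)] Mu_Suc.IH(2)[OF Mu_Suc.prems, unfolded e(1)]
  have "t + u + 2 = u + Suc (t + 1)" by simp
  then show ?case
    by (simp only: funpow_add funpow.simps comp_apply)
      (simp add: e(1) enter_step_simps return_step_simps IH del: add_Suc_right)
next
  case (Zero x)
  then show ?case
    by (cases e rule: program_cases) (auto simp: enter_step_simps[unfolded One_nat_def])
next
  case (Succ x)
  then show ?case
    by (cases e rule: program_cases) (auto simp: enter_step_simps[unfolded One_nat_def])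
next
  case (Fst x)
  then show ?case
    by (cases e rule: program_cases) (auto simp: enter_step_simps[unfolded One_nat_def])
next
  case (Snd x)
  then show ?case
    by (cases e rule: program_cases) (auto simp: enter_step_simps[unfolded One_nat_def])
qed

section \<open>From halting runs back to computations\<close>

definition halts_in :: "nat \<Rightarrow> nat \<Rightarrow> bool" where
  "halts_in n c \<longleftrightarrow> (\<exists>z. (machine_step ^^ n) c = return z 0)"

lemma enter_neq_return: "enter e x K \<noteq> return y L"
  by (simp add: enter_def return_def prod_encode_eq)

lemma return_eq_iff: "return y K = return z L \<longleftrightarrow> y = z \<and> K = L"
  by (simp add: return_def prod_encode_eq)

text \<open>A configuration that enters a program is not halting, so at least one step
  remains.\<close>

lemma halts_in_enterE:
  assumes "halts_in n (enter e x K)"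
  obtains m where "n = Suc m" "halts_in m (enter_step e x K)"
  using assms enter_neq_return
  by (cases n) (auto simp: halts_in_def funpow_Suc_right simp del: funpow.simps(2))

text \<open>Returning to a nonempty stack is not halting either.\<close>

lemma halts_in_return_pushE:
  assumes "halts_in n (return y (push tag a K))"
  obtains m where "n = Suc m" "halts_in m (return_step y (push tag a K))"
  using assms
  by (cases n) (auto simp: halts_in_def push_def return_eq_iff funpow_Suc_right
      simp del: funpow.simps(2))

text \<open>A halting run must pop everything it has pushed, hence pass through a return to
  \<open>K\<close>; the run is cut there and \<open>m\<close> steps are left over. The induction is
  on the length of the run, because \<open>Prec\<close> and \<open>Mu\<close> enter the same program
  again.\<close>

lemma machine_complete:
  "halts_in n (enter e x K) \<Longrightarrow>
    \<exists>y t m. computes (program e) x y t \<and> n = t + m \<and> halts_in m (return y K)"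
proof (induction n arbitrary: e x K rule: less_induct)
  case (less n)
  from less.prems obtain n1 where n1: "n = Suc n1" "halts_in n1 (enter_step e x K)"
    by (rule halts_in_enterE)
  then have n1_less: "n1 < n" by simp
  show ?case
  proof (cases e rule: program_cases)
    case 1
    then show ?thesis using n1 computes.Zero by (force simp: enter_step_simps)
  next
    case 2
    then show ?thesis using n1 computes.Succ by (force simp: enter_step_simps[simplified])
  next
    case 3
    then show ?thesis using n1 computes.Fst by (force simp: enter_step_simps)
  next
    case 4
    then show ?thesis using n1 computes.Snd by (force simp: enter_step_simps)
  next
    case (5 i j)
    obtain y t n2 where 1: "computes (program i) x y t" "n1 = t + n2"
      "halts_in n2 (return y (push 0 (prod_encode (j, x)) K))"
      using less.IH[OF n1_less n1(2)[unfolded 5 enter_step_simps]] by blast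
    obtain n3 where 2: "n2 = Suc n3" "halts_in n3 (enter j x (push 1 y K))"
      using 1(3) by (rule halts_in_return_pushE) (simp add: return_step_simps)
    obtain z u n4 where 3: "computes (program j) x z u" "n3 = u + n4"
      "halts_in n4 (return z (push 1 y K))"
      using less.IH[OF _ 2(2)] 2(1) 1(2) n1(1) by force
    obtain n5 where 4: "n4 = Suc n5" "halts_in n5 (return (prod_encode (y, z)) K)"
      using 3(3)
      by (rule halts_in_return_pushE) (simp add: return_step_simps del: One_nat_def)
    show ?thesis
      using computes.Pairing[OF 1(1) 3(1)] n1(1) 1(2) 2(1) 3(2) 4 5(2)
      by (intro exI[of _ "prod_encode (y, z)"] exI[of _ "t + u + 3"] exI[of _ n5]) auto
  next
    case (6 i j)
    obtain y t n2 where 1: "computes (program j) x y t" "n1 = t + n2"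
      "halts_in n2 (return y (push 2 i K))"
      using less.IH[OF n1_less n1(2)[unfolded 6 enter_step_simps]] by blast
    obtain n3 where 2: "n2 = Suc n3" "halts_in n3 (enter i y K)"
      using 1(3) by (rule halts_in_return_pushE) (simp add: return_step_simps)
    obtain z u n4 where 3: "computes (program i) y z u" "n3 = u + n4" "halts_in n4 (return z K)"
      using less.IH[OF _ 2(2)] 2(1) 1(2) n1(1) by force
    show ?thesis
      using computes.Comp[OF 1(1) 3(1)] n1(1) 1(2) 2(1) 3(2,3) 6(2)
      by (intro exI[of _ z] exI[of _ "t + u + 2"] exI[of _ n4]) auto
  next
    case (7 i j)
    obtain a m where x: "x = prod_encode (a, m)"
      by (metis prod.collapse prod_decode_inverse)
    show ?thesis
    proof (cases m)
      case 0
      obtain y t n2 where 1: "computes (program i) a y t" "n1 = t + n2" "halts_in n2 (return y K)"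
        using less.IH[OF n1_less n1(2)[unfolded 7 x 0 enter_step_simps]] by blast
      then show ?thesis
        using computes.Prec_0[OF 1(1)] n1(1) 7(2)
        by (intro exI[of _ y] exI[of _ "t + 1"] exI[of _ n2]) (auto simp: x 0)
    next
      case (Suc m')
      obtain y t n2 where 1: "computes (program e) (prod_encode (a, m')) y t" "n1 = t + n2"
        "halts_in n2 (return y (push 3 (prod_encode (j, prod_encode (a, m'))) K))"
        using less.IH[OF n1_less n1(2)[unfolded 7 x Suc enter_step_simps, folded 7(1)]] by blast
      obtain n3 where 2: "n2 = Suc n3"
        "halts_in n3 (enter j (prod_encode (a, prod_encode (m', y))) K)"
        using 1(3) by (rule halts_in_return_pushE) (simp add: return_step_simps)
      obtain z u n4 where 3: "computes (program j) (prod_encode (a, prod_encode (m', y))) z u"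
        "n3 = u + n4" "halts_in n4 (return z K)"
        using less.IH[OF _ 2(2)] 2(1) 1(2) n1(1) by force
      show ?thesis
        using computes.Prec_Suc[OF 1(1)[unfolded 7(2)] 3(1)] n1(1) 1(2) 2(1) 3(2,3)
        unfolding 7(2) x Suc
        by (intro exI[of _ z] exI[of _ "t + u + 2"] exI[of _ n4]) auto
    qed
  next
    case (8 d)
    obtain a m where x: "x = prod_encode (a, m)"
      by (metis prod.collapse prod_decode_inverse)
    obtain y t n2 where 1: "computes (program d) (prod_encode (a, m)) y t" "n1 = t + n2"
      "halts_in n2 (return y (push 4 (prod_encode (e, prod_encode (a, m))) K))"
      using less.IH[OF n1_less n1(2)[unfolded 8 x enter_step_simps, folded 8(1)]] by blast
    show ?thesis
    proof (cases y)
      case 0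
      obtain n3 where 2: "n2 = Suc n3" "halts_in n3 (return m K)"
        using 1(3) by (rule halts_in_return_pushE) (simp add: 0 return_step_simps)
      show ?thesis
        using computes.Mu_0[OF 1(1)[unfolded 0]] n1(1) 1(2) 2 unfolding 8(2) x
        by (intro exI[of _ m] exI[of _ "t + 2"] exI[of _ n3]) auto
    next
      case (Suc y')
      obtain n3 where 2: "n2 = Suc n3" "halts_in n3 (enter e (prod_encode (a, Suc m)) K)"
        using 1(3) by (rule halts_in_return_pushE) (simp add: Suc return_step_simps)
      obtain z u n4 where 3: "computes (program e) (prod_encode (a, Suc m)) z u"
        "n3 = u + n4" "halts_in n4 (return z K)"
        using less.IH[OF _ 2(2)] 2(1) 1(2) n1(1) by force
      show ?thesis
        using computes.Mu_Suc[OF 1(1)[unfolded Suc] 3(1)[unfolded 8(2)]] n1(1) 1(2) 2(1) 3(2,3)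
        unfolding 8(2) x
        by (intro exI[of _ z] exI[of _ "t + u + 2"] exI[of _ n4]) auto
    qed
  qed
qed

section \<open>Simulation with a step bound\<close>

definition run :: "nat \<Rightarrow> nat \<Rightarrow> nat \<Rightarrow> nat" where
  "run e x t = rec_nat (enter e x 0) (\<lambda>_. machine_step) t"

text \<open>Rebuilding the configuration from its own value replaces the quantifier over outputs by
  an equation, which is decidable.\<close>

definition halted :: "nat \<Rightarrow> bool" where
  "halted c \<longleftrightarrow> c = return (pfst (psnd c)) 0"

lemma halted_iff: "halted c \<longleftrightarrow> (\<exists>y. c = return y 0)"
  by (auto simp: halted_def return_def)

lemma run_eq: "run e x t = (machine_step ^^ t) (enter e x 0)"
  by (induction t) (simp_all add: run_def)

text \<open>After \<open>u\<close> steps the configuration is a fixed point, so the surplus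
  \<open>t - u\<close> steps are idle.\<close>

lemma run_eq_return:
  assumes "computes (program e) x y u" "u \<le> t"
  shows "run e x t = return y 0"
proof -
  have "(machine_step ^^ n) (return y 0) = return y 0" for n
    by (induction n) (simp_all add: return_step_simps)
  moreover have "run e x t = (machine_step ^^ (t - u + u)) (enter e x 0)"
    using assms(2) by (simp add: run_eq)
  ultimately show ?thesis
    by (simp only: funpow_add comp_apply machine_sound[OF assms(1) refl])
qed

text \<open>Completeness of the machine gives one direction, soundness the other. Thus a bounded
  search over derivations becomes a computable test.\<close>

lemma halted_run_iff: "halted (run e x t) \<longleftrightarrow> (\<exists>y. \<exists>u\<le>t. computes (program e) x y u)"
proof
  assume "halted (run e x t)"
  then have "halts_in t (enter e x 0)"
    by (auto simp: halted_iff halts_in_def run_eq)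
  from machine_complete[OF this] show "\<exists>y. \<exists>u\<le>t. computes (program e) x y u"
    by (metis le_add1)
qed (auto simp: halted_iff run_eq_return)

lemma ce_set_stage_iff: "x \<in> ce_set_stage e s \<longleftrightarrow> x < s \<and> halted (run e x s)"
  by (auto simp: ce_set_stage_def halted_run_iff)

section \<open>Computability of the simulation\<close>

lemma computable_enter [computable_intros]:
  "computable f \<Longrightarrow> computable g \<Longrightarrow> computable h \<Longrightarrow> computable (\<lambda>x. enter (f x) (g x) (h x))"
  unfolding enter_def by (intro computable_intros)

lemma computable_return [computable_intros]:
  "computable f \<Longrightarrow> computable g \<Longrightarrow> computable (\<lambda>x. return (f x) (g x))"
  unfolding return_def by (intro computable_intros)

lemma computable_push [computable_intros]:
  "computable f \<Longrightarrow> computable g \<Longrightarrow> computable h \<Longrightarrow> computable (\<lambda>x. push (f x) (g x) (h x))"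
  unfolding push_def by (intro computable_intros)

lemma computable_enter_step [computable_intros]:
  "computable f \<Longrightarrow> computable g \<Longrightarrow> computable h \<Longrightarrow> computable (\<lambda>x. enter_step (f x) (g x) (h x))"
  unfolding enter_step_def Let_def by (intro computable_intros)

lemma computable_return_step [computable_intros]:
  "computable f \<Longrightarrow> computable g \<Longrightarrow> computable (\<lambda>x. return_step (f x) (g x))"
  unfolding return_step_def Let_def by (intro computable_intros)

lemma computable_machine_step [computable_intros]:
  "computable f \<Longrightarrow> computable (\<lambda>x. machine_step (f x))"
  unfolding machine_step_def Let_def by (intro computable_intros)

lemma computable_run [computable_intros]:
  "computable f \<Longrightarrow> computable g \<Longrightarrow> computable h \<Longrightarrow> computable (\<lambda>x. run (f x) (g x) (h x))"
  unfolding run_def by (intro computable_intros)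

lemma decidable_halted [computable_intros]:
  "computable f \<Longrightarrow> decidable (\<lambda>x. halted (f x))"
  unfolding halted_def by (intro computable_intros)


section \<open>Coded relations\<close>

text \<open>
  A number codes a relation through the finite set of pairs given by its binary digits, the diagonal
  being added for free.
\<close>

definition linked :: "nat \<Rightarrow> nat \<Rightarrow> nat \<Rightarrow> bool" where
  "linked S x y \<longleftrightarrow> x = y \<or> odd (S div 2 ^ prod_encode (x, y))"

definition decode_rel :: "nat \<Rightarrow> nat rel" where
  "decode_rel S = {(x, y). linked S x y}"

text \<open>On a coded equivalence relation this unites the classes of the two components of
  \<open>p\<close>. The cutoff loses nothing: off the diagonal the entries are below
  \<open>S\<close> or components of \<open>p\<close>, hence at most \<open>S + p\<close>.\<close>

definition merge :: "nat \<Rightarrow> nat \<Rightarrow> nat" where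
  "merge S p = set_encode {i. i < Suc (prod_encode (S + p, S + p)) \<and>
    (linked S (pfst i) (psnd i) \<or>
     linked S (pfst i) (pfst p) \<and> linked S (psnd p) (psnd i) \<or>
     linked S (pfst i) (psnd p) \<and> linked S (pfst p) (psnd i))}"

lemma linked_refl [simp]: "linked S x x"
  by (simp add: linked_def)

text \<open>A digit set at position \<open>i\<close> forces \<open>i < 2 ^ i \<le> S\<close>, and a
  pair code dominates both components. So from \<open>S\<close> on all classes are
  singletons.\<close>

lemma linked_bound:
  assumes "linked S x y" "x \<noteq> y"
  shows "x < S" "y < S"
proof -
  have "S div 2 ^ prod_encode (x, y) \<noteq> 0"
    using assms by (auto simp: linked_def intro!: Nat.gr0I)
  then have "2 ^ prod_encode (x, y) \<le> S"
    by (meson div_less not_le)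
  then have "prod_encode (x, y) < S"
    using less_exp[of "prod_encode (x, y)"] by linarith
  then show "x < S" "y < S"
    using le_prod_encode_1[of x y] le_prod_encode_2[of y x] by linarith+
qed

lemma prod_encode_mono:
  assumes "a \<le> c" "b \<le> d"
  shows "prod_encode (a, b) \<le> prod_encode (c, d)"
  unfolding prod_encode_def triangle_def using assms
  by (auto intro!: add_mono div_le_mono mult_mono)

lemma linked_merge:
  "linked (merge S p) u v \<longleftrightarrow> linked S u v \<or>
     linked S u (pfst p) \<and> linked S (psnd p) v \<or> linked S u (psnd p) \<and> linked S (pfst p) v"
  (is "_ \<longleftrightarrow> ?R u v")
proof (cases "u = v")
  case False
  let ?A = "{i. i < Suc (prod_encode (S + p, S + p)) \<and> ?R (pfst i) (psnd i)}"
  have "linked (merge S p) u v \<longleftrightarrow> prod_encode (u, v) \<in> set_decode (set_encode ?A)"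
    using False by (simp add: linked_def merge_def set_decode_def)
  also have "\<dots> \<longleftrightarrow> prod_encode (u, v) \<in> ?A"
    by (subst set_encode_inverse) simp_all
  also have "\<dots> \<longleftrightarrow> ?R u v"
  proof -
    have "prod_encode (u, v) < Suc (prod_encode (S + p, S + p))" if "?R u v"
    proof -
      have "a \<le> S + p" if "linked S a b \<or> linked S b a" "b \<le> p" for a b
        using that linked_bound[of S a b] linked_bound[of S b a] by (cases "a = b") auto
      then have "u \<le> S + p" "v \<le> S + p"
        using \<open>?R u v\<close> False pfst_le[of p] psnd_le[of p] linked_bound[of S u v]
        by fastforce+
      then show ?thesis
        using prod_encode_mono by (simp add: less_Suc_eq_le)
    qed
    then show ?thesis by auto
  qed
  finally show ?thesis .
qed simp

section \<open>Adding one pair to an equivalence relation\<close>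

lemma equiv_UNIV_iff: "equiv UNIV E \<Longrightarrow> (a, b) \<in> E \<longleftrightarrow> E `` {a} = E `` {b}"
  by (simp add: eq_equiv_class_iff)

text \<open>One new pair unites at most two classes, so the closure is explicit and needs no
  iteration.\<close>

lemma equiv_closure_insert:
  assumes "equiv UNIV E"
  shows "equiv_closure (insert (x, y) E) =
    E \<union> {(u, v). (u, x) \<in> E \<and> (y, v) \<in> E \<or> (u, y) \<in> E \<and> (x, v) \<in> E}" (is "_ = ?R")
proof
  note E = equiv_UNIV_iff[OF assms]
  \<comment> \<open>Rewriting membership as equality of classes turns the laws of an equivalence
    into reasoning about equations.\<close>
  have R: "(u, v) \<in> ?R \<longleftrightarrow> E `` {u} = E `` {v} \<or> E `` {u} = E `` {x} \<and> E `` {y} = E `` {v} \<or>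
      E `` {u} = E `` {y} \<and> E `` {x} = E `` {v}" for u v
    by (simp add: E)
  have "equiv UNIV ?R"
    by (intro equivI refl_onI symI transI) (simp_all only: R UNIV_I, auto)
  moreover have "insert (x, y) E \<subseteq> ?R"
    by (auto simp: E)
  ultimately show "equiv_closure (insert (x, y) E) \<subseteq> ?R"
    by (rule equiv_closure_least)
next
  let ?C = "equiv_closure (insert (x, y) E)"
  note C = equiv_UNIV_iff[OF equiv_equiv_closure, of _ _ "insert (x, y) E"]
  have "E \<subseteq> ?C" "(x, y) \<in> ?C"
    using subset_equiv_closure[of "insert (x, y) E"] by auto
  then have "(u, v) \<in> E \<Longrightarrow> ?C `` {u} = ?C `` {v}" "?C `` {x} = ?C `` {y}" for u v
    unfolding C[symmetric] by blast+
  then show "?R \<subseteq> ?C"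
    by (auto simp: C)
qed

lemma decode_rel_0: "decode_rel 0 = Id"
  by (auto simp: decode_rel_def linked_def)

lemma decode_rel_merge:
  assumes "equiv UNIV (decode_rel S)"
  shows "decode_rel (merge S p) = equiv_closure (insert (prod_decode p) (decode_rel S))"
proof -
  have "decode_rel (merge S p) = equiv_closure (insert (pfst p, psnd p) (decode_rel S))"
    unfolding equiv_closure_insert[OF assms] by (auto simp: decode_rel_def linked_merge)
  then show ?thesis by simp
qed

text \<open>By \<open>linked_bound\<close> only numbers below \<open>S\<close> need inspection,
  which makes the size test decidable.\<close>

definition bounded_code :: "nat \<Rightarrow> nat \<Rightarrow> bool" where
  "bounded_code k S \<longleftrightarrow> (\<forall>x<S. card {y. y < S \<and> linked S x y} \<le> k)"

lemma bounded_code_iff: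
  assumes "k > 0"
  shows "bounded_code k S \<longleftrightarrow> k_bounded k (decode_rel S)"
proof -
  have class_less: "decode_rel S `` {x} = {y. y < S \<and> linked S x y}" if "x < S" for x
    using that linked_bound(2)[of S x] by (auto simp: decode_rel_def)
  have class_ge: "decode_rel S `` {x} = {x}" if "\<not> x < S" for x
    using that linked_bound(1)[of S x] by (auto simp: decode_rel_def)
  have "finite (decode_rel S `` {x}) \<and> card (decode_rel S `` {x}) \<le> k \<longleftrightarrow>
    (x < S \<longrightarrow> card {y. y < S \<and> linked S x y} \<le> k)" for x
    using class_less[of x] class_ge[of x] assms by (cases "x < S") auto
  then show ?thesis
    by (simp add: k_bounded_def bounded_code_def)
qed

definition ceer_code :: "nat \<Rightarrow> nat \<Rightarrow> nat" where
  "ceer_code e t = rec_nat 0 (\<lambda>n S. if halted (run e n t) then merge S n else S) t"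

text \<open>Allows the closure of a finite set to be built pair by pair, as \<open>ceer_code\<close>
  does.\<close>

lemma equiv_closure_insert_equiv_closure:
  "equiv_closure (insert p (equiv_closure R)) = equiv_closure (insert p R)"
proof
  have "equiv_closure R \<subseteq> equiv_closure (insert p R)"
    by (rule equiv_closure_mono) auto
  then show "equiv_closure (insert p (equiv_closure R)) \<subseteq> equiv_closure (insert p R)"
    using subset_equiv_closure[of "insert p R"]
    by (intro equiv_closure_least equiv_equiv_closure) auto
  show "equiv_closure (insert p R) \<subseteq> equiv_closure (insert p (equiv_closure R))"
    using subset_equiv_closure[of R] by (intro equiv_closure_mono) auto
qed

lemma decode_rel_ceer_code: "decode_rel (ceer_code e t) = ceer_stage e t"
proof -
  let ?S = "rec_nat 0 (\<lambda>n S. if halted (run e n t) then merge S n else S)"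
  let ?P = "\<lambda>n. {p. prod_encode p < n \<and> halted (run e (prod_encode p) t)}"
  \<comment> \<open>The number \<open>n\<close> of processed codes varies while the time bound
    \<open>t\<close> stays fixed; only afterwards is \<open>n\<close> set to
    \<open>t\<close>.\<close>
  have "decode_rel (?S n) = equiv_closure (?P n)" for n
  proof (induction n)
    case 0
    then show ?case by (simp add: decode_rel_0 equiv_closure_def)
  next
    case (Suc n)
    have less_Suc: "prod_encode p < Suc n \<longleftrightarrow> prod_encode p < n \<or> p = prod_decode n" for p
      by (metis less_Suc_eq prod_decode_inverse prod_encode_inverse)
    show ?case
    proof (cases "halted (run e n t)")
      case True
      then have "?P (Suc n) = insert (prod_decode n) (?P n)"
        unfolding less_Suc by auto
      with True Suc show ?thesis
        by (simp add: decode_rel_merge equiv_equiv_closure equiv_closure_insert_equiv_closure)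
    next
      case False
      then have "?P (Suc n) = ?P n"
        unfolding less_Suc by auto
      with False Suc show ?thesis by simp
    qed
  qed
  moreover have "?P t = {(x, y). prod_encode (x, y) \<in> ce_set_stage e t}"
    by (auto simp: ce_set_stage_iff)
  ultimately show ?thesis
    by (simp add: ceer_code_def ceer_stage_def)
qed

definition B_code :: "nat \<Rightarrow> nat \<Rightarrow> nat \<Rightarrow> nat" where
  "B_code k e s = rec_nat 0 (\<lambda>s S.
     if linked (ceer_code e (psnd s)) (pfst (pfst s)) (psnd (pfst s)) \<and>
        bounded_code k (merge S (pfst s))
     then merge S (pfst s) else S) s"

text \<open>Identifies the computed codes with the stages of \<open>B_ceer k e\<close>; the index
  \<open>e\<close> is an argument of the computation, as \<open>B_inf\<close> requires.\<close>

lemma decode_rel_B_code: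
  assumes "k > 0"
  shows "decode_rel (B_code k e s) = B_stage k e s"
proof (induction s)
  case 0
  show ?case by (simp add: B_code_def decode_rel_0)
next
  case (Suc s)
  have "linked (ceer_code e (psnd s)) (pfst (pfst s)) (psnd (pfst s)) \<longleftrightarrow>
      prod_decode (pfst s) \<in> ceer_stage e (psnd s)"
    by (simp add: decode_rel_ceer_code[symmetric] decode_rel_def split_def)
  moreover have "decode_rel (merge (B_code k e s) (pfst s)) =
      equiv_closure (insert (prod_decode (pfst s)) (B_stage k e s))"
    using decode_rel_merge[of "B_code k e s"] Suc equiv_B_stage by simp
  ultimately show ?case
    using Suc by (simp add: B_code_def bounded_code_iff[OF assms] Let_def split_def)
qed

section \<open>Computability of the coded stages\<close>

lemma decidable_linked [computable_intros]:
  "computable f \<Longrightarrow> computable g \<Longrightarrow> computable h \<Longrightarrow> decidable (\<lambda>x. linked (f x) (g x) (h x))"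
  unfolding linked_def by (intro computable_intros)

lemma computable_merge [computable_intros]:
  assumes "computable f" "computable g"
  shows "computable (\<lambda>x. merge (f x) (g x))"
  unfolding merge_def
  by (intro computable_intros assms computable_compose[OF assms(1)] computable_compose[OF assms(2)])

lemma decidable_bounded_code [computable_intros]:
  assumes "computable f"
  shows "decidable (\<lambda>x. bounded_code k (f x))"
  unfolding bounded_code_def
  by (intro computable_intros assms computable_compose[OF assms])

lemma computable_ceer_code [computable_intros]:
  assumes "computable f" "computable g"
  shows "computable (\<lambda>x. ceer_code (f x) (g x))"
  unfolding ceer_code_def
  by (intro computable_intros assms computable_compose[OF assms(1)] computable_compose[OF assms(2)])

lemma computable_B_code [computable_intros]:
  assumes "computable f" "computable g"
  shows "computable (\<lambda>x. B_code k (f x) (g x))"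
  unfolding B_code_def
  by (intro computable_intros assms computable_compose[OF assms(1)] computable_compose[OF assms(2)])


section \<open>Universality of \<open>B_inf\<close>\<close>

lemma prod_encode_image: "prod_encode ` R = {n. (pfst n, psnd n) \<in> R}"
  by (auto simp: image_iff) (metis prod_decode_inverse)

lemma B_inf_iff: "(m, n) \<in> B_inf k \<longleftrightarrow> psnd m = psnd n \<and> (pfst m, pfst n) \<in> B_ceer k (psnd m)"
proof
  assume "psnd m = psnd n \<and> (pfst m, pfst n) \<in> B_ceer k (psnd m)"
  moreover have "m = prod_encode (pfst m, psnd m)" "n = prod_encode (pfst n, psnd n)"
    by simp_all
  ultimately show "(m, n) \<in> B_inf k"
    unfolding B_inf_def by (metis (mono_tags, lifting) mem_Collect_eq)
qed (auto simp: B_inf_def)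

text \<open>A pair is enumerated by searching for a stage of its common column. The index of that
  column is read off the input, so uniformity of \<open>B_code\<close> in the index is
  essential.\<close>

lemma ceer_B_inf:
  assumes "k > 0"
  shows "ceer (B_inf k)"
  unfolding ceer_def
proof
  show "equiv UNIV (B_inf k)"
    by (intro equivI refl_onI symI transI) (auto simp: B_inf_iff equiv_UNIV_iff[OF equiv_B_ceer])
  have "decidable (\<lambda>p. psnd (pfst (pfst p)) = psnd (psnd (pfst p)) \<and>
      linked (B_code k (psnd (pfst (pfst p))) (psnd p)) (pfst (pfst (pfst p))) (pfst (psnd (pfst p))))"
    by (intro computable_intros)
  then have "ce {n. \<exists>s. psnd (pfst n) = psnd (psnd n) \<and>
      linked (B_code k (psnd (pfst n)) s) (pfst (pfst n)) (pfst (psnd n))}"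
    by (rule ce_Ex)
  moreover have linked_B_code: "linked (B_code k e s) x y \<longleftrightarrow> (x, y) \<in> B_stage k e s" for e s x y
    by (simp add: decode_rel_B_code[OF assms, symmetric] decode_rel_def)
  have "prod_encode ` B_inf k = {n. \<exists>s. psnd (pfst n) = psnd (psnd n) \<and>
      linked (B_code k (psnd (pfst n)) s) (pfst (pfst n)) (pfst (psnd n))}"
    unfolding prod_encode_image B_inf_iff B_ceer_def linked_B_code by auto
  ultimately show "ce (prod_encode ` B_inf k)"
    by simp
qed

text \<open>Each class lies within one column, where it is a copy of a class of
  \<open>B_ceer\<close>.\<close>

lemma k_bounded_B_inf:
  assumes "k > 0"
  shows "k_bounded k (B_inf k)"
  unfolding k_bounded_def
proof
  fix m
  let ?C = "B_ceer k (psnd m) `` {pfst m}"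
  have C: "finite ?C" "card ?C \<le> k"
    using k_bounded_B_ceer[OF assms] by (simp_all add: k_bounded_def)
  have "B_inf k `` {m} \<subseteq> (\<lambda>x. prod_encode (x, psnd m)) ` ?C"
  proof
    fix n assume "n \<in> B_inf k `` {m}"
    then show "n \<in> (\<lambda>x. prod_encode (x, psnd m)) ` ?C"
      by (intro image_eqI[of _ _ "pfst n"]) (auto simp: B_inf_iff)
  qed
  then show "finite (B_inf k `` {m}) \<and> card (B_inf k `` {m}) \<le> k"
    using C by (meson finite_surj surj_card_le order_trans)
qed

lemma k_bounded_ceer_le_B_inf:
  assumes "ceer R" "k_bounded k R"
  shows "R \<le>\<^sub>c B_inf k"
proof -
  obtain e where "B_ceer k e = R"
    using B_ceer_exhaustive[OF assms] by blast
  moreover have "computable (\<lambda>x. prod_encode (x, e))"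
    by (intro computable_intros)
  ultimately show ?thesis
    unfolding reducible_def by (intro exI[of _ "\<lambda>x. prod_encode (x, e)"]) (simp add: B_inf_iff)
qed


section \<open>Diagonalisation\<close>

text \<open>The numbers \<open>prod_encode (e, i)\<close> with \<open>i < n\<close> are reserved for
  program \<open>e\<close>. Comparing halted configurations amounts to comparing outputs, since both
  stacks are empty.\<close>

definition separates_at :: "nat \<Rightarrow> nat \<Rightarrow> nat \<Rightarrow> bool" where
  "separates_at n e t \<longleftrightarrow>
    (\<forall>i<n. halted (run e (prod_encode (e, i)) t) \<and>
       (\<forall>j<n. run e (prod_encode (e, i)) t = run e (prod_encode (e, j)) t \<longrightarrow> i = j))"

text \<open>The quantifier over \<open>t\<close> is pulled to the front to fit
  \<open>ce_Ex\<close>.\<close>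

definition diagonal_ceer :: "nat \<Rightarrow> nat rel" where
  "diagonal_ceer n = {(x, y). \<exists>t. x = y \<or>
     pfst x = pfst y \<and> psnd x < n \<and> psnd y < n \<and> separates_at n (pfst x) t}"

lemma ceer_diagonal_ceer: "ceer (diagonal_ceer n)"
  unfolding ceer_def
proof
  show "equiv UNIV (diagonal_ceer n)"
    by (intro equivI refl_onI symI transI) (auto simp: diagonal_ceer_def)
  have "decidable (\<lambda>p. pfst (pfst p) = psnd (pfst p) \<or>
      pfst (pfst (pfst p)) = pfst (psnd (pfst p)) \<and> psnd (pfst (pfst p)) < n \<and>
      psnd (psnd (pfst p)) < n \<and> separates_at n (pfst (pfst (pfst p))) (psnd p))"
    unfolding separates_at_def by (intro computable_intros)
  then have "ce {m. \<exists>t. pfst m = psnd m \<or> pfst (pfst m) = pfst (psnd m) \<and> psnd (pfst m) < n \<and>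
      psnd (psnd m) < n \<and> separates_at n (pfst (pfst m)) t}"
    by (rule ce_Ex)
  moreover have "prod_encode ` diagonal_ceer n = {m. \<exists>t. pfst m = psnd m \<or>
      pfst (pfst m) = pfst (psnd m) \<and> psnd (pfst m) < n \<and>
      psnd (psnd m) < n \<and> separates_at n (pfst (pfst m)) t}"
    by (simp only: prod_encode_image diagonal_ceer_def mem_Collect_eq case_prod_conv)
  ultimately show "ce (prod_encode ` diagonal_ceer n)"
    by simp
qed

lemma k_bounded_diagonal_ceer:
  assumes "n > 0"
  shows "k_bounded n (diagonal_ceer n)"
  unfolding k_bounded_def
proof
  fix x
  show "finite (diagonal_ceer n `` {x}) \<and> card (diagonal_ceer n `` {x}) \<le> n"
  proof (cases "psnd x < n")
    case True
    then have "diagonal_ceer n `` {x} \<subseteq> (\<lambda>i. prod_encode (pfst x, i)) ` {..<n}"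
      by (auto simp: diagonal_ceer_def image_iff) (metis lessThan_iff prod.collapse prod_decode_inverse)+
    then show ?thesis
      by (metis card_lessThan finite_lessThan finite_surj surj_card_le)
  next
    case False
    then have "diagonal_ceer n `` {x} = {x}"
      by (auto simp: diagonal_ceer_def)
    with assms show ?thesis by simp
  qed
qed

lemma diagonal_ceer_not_reducible:
  assumes "equiv UNIV S" "k_bounded k S" "k < n"
  shows "\<not> diagonal_ceer n \<le>\<^sub>c S"
proof
  assume "diagonal_ceer n \<le>\<^sub>c S"
  then obtain f where "computable f" and f: "\<And>x y. (x, y) \<in> diagonal_ceer n \<longleftrightarrow> (f x, f y) \<in> S"
    unfolding reducible_def by blast
  then obtain e where "\<forall>x. \<exists>t. computes (program e) x (f x) t"
    using surj_program unfolding computable_def by (metis surjD)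
  then obtain T where T: "\<And>x. computes (program e) x (f x) (T x)"
    by metis
  let ?w = "\<lambda>i. prod_encode (e, i)"
  \<comment> \<open>The sum of the halting times bounds each of them, so all \<open>n\<close> runs
    have halted by \<open>t\<close>.\<close>
  define t where "t = (\<Sum>i<n. T (?w i))"
  have run: "run e (?w i) t = return (f (?w i)) 0" if "i < n" for i
    using that member_le_sum[of i "{..<n}" "\<lambda>i. T (?w i)"]
    by (intro run_eq_return[OF T]) (simp add: t_def)
  \<comment> \<open>Equal outputs are related by reflexivity of \<open>S\<close>, so the two points
    are related in \<open>diagonal_ceer n\<close>. Unless they coincide, the collapse has taken
    place, and its trigger required distinct outputs.\<close>
  have inj: "inj_on (\<lambda>i. f (?w i)) {..<n}"
  proof (rule inj_onI)
    fix i j assume ij: "i \<in> {..<n}" "j \<in> {..<n}" "f (?w i) = f (?w j)"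
    have "(f (?w i), f (?w j)) \<in> S"
      using assms(1) ij(3) by (simp add: equiv_def refl_on_def)
    then have "(?w i, ?w j) \<in> diagonal_ceer n"
      by (simp add: f)
    then obtain t' where "?w i = ?w j \<or> separates_at n e t'"
      by (auto simp: diagonal_ceer_def)
    then show "i = j"
    proof
      assume sep: "separates_at n e t'"
      \<comment> \<open>By determinism the outputs seen at the triggering stage are the values of
        \<open>f\<close>.\<close>
      have "run e (?w l) t' = return (f (?w l)) 0" if "l < n" for l
      proof -
        from sep that have "halted (run e (?w l) t')"
          by (simp add: separates_at_def)
        then obtain y u where "u \<le> t'" "computes (program e) (?w l) y u"
          by (auto simp: halted_run_iff)
        moreover from this have "y = f (?w l)"
          using computes_deterministic[OF T] by blast
        ultimately show ?thesis
          by (simp add: run_eq_return)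
      qed
      with ij sep show "i = j"
        by (simp add: separates_at_def)
    qed (simp add: prod_encode_eq)
  qed
  \<comment> \<open>Injectivity now forces the collapse, which sends \<open>n > k\<close> distinct
    values into one class of \<open>S\<close>.\<close>
  have "separates_at n e t"
    unfolding separates_at_def
  proof (intro allI impI conjI)
    fix i j assume "i < n"
    then show "halted (run e (?w i) t)"
      by (simp add: run halted_iff return_eq_iff)
    assume "j < n" "run e (?w i) t = run e (?w j) t"
    with \<open>i < n\<close> show "i = j"
      using inj by (auto simp: run return_eq_iff dest: inj_onD)
  qed
  then have "(?w 0, ?w i) \<in> diagonal_ceer n" if "i < n" for i
    using that by (auto simp: diagonal_ceer_def)
  then have "(\<lambda>i. f (?w i)) ` {..<n} \<subseteq> S `` {f (?w 0)}"
    using f by auto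
  then have "card ((\<lambda>i. f (?w i)) ` {..<n}) \<le> k"
    using assms(2) by (meson card_mono k_bounded_def order_trans)
  with inj assms(3) show False
    by (simp add: card_image)
qed

lemma reducible_trans:
  assumes "R \<le>\<^sub>c S" "S \<le>\<^sub>c T"
  shows "R \<le>\<^sub>c T"
proof -
  from assms obtain f g where "computable f" "\<And>x y. (x, y) \<in> R \<longleftrightarrow> (f x, f y) \<in> S"
    "computable g" "\<And>x y. (x, y) \<in> S \<longleftrightarrow> (g x, g y) \<in> T"
    unfolding reducible_def by blast
  then show ?thesis
    unfolding reducible_def by (intro exI[of _ "\<lambda>x. g (f x)"]) (simp add: computable_compose)
qed

theorem theorem6p3:
  fixes k :: nat
  assumes "k > 0"
  shows "B_inf k <\<^sub>c B_inf (k + 1)"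
proof -
  \<comment> \<open>The bound \<open>k\<close> may be weakened to \<open>k + 1\<close>, so
    universality of \<open>B_inf (k + 1)\<close> applies to \<open>B_inf k\<close> itself.\<close>
  have "k_bounded (k + 1) (B_inf k)"
    using k_bounded_B_inf[OF assms] by (auto simp: k_bounded_def intro: le_SucI)
  then have "B_inf k \<le>\<^sub>c B_inf (k + 1)"
    using ceer_B_inf[OF assms] by (rule k_bounded_ceer_le_B_inf[rotated])
  moreover have "\<not> B_inf (k + 1) \<le>\<^sub>c B_inf k"
  proof
    assume "B_inf (k + 1) \<le>\<^sub>c B_inf k"
    moreover have "diagonal_ceer (k + 1) \<le>\<^sub>c B_inf (k + 1)"
      by (intro k_bounded_ceer_le_B_inf ceer_diagonal_ceer k_bounded_diagonal_ceer) simp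
    ultimately have "diagonal_ceer (k + 1) \<le>\<^sub>c B_inf k"
      using reducible_trans by blast
    moreover have "equiv UNIV (B_inf k)"
      using ceer_B_inf[OF assms] by (simp add: ceer_def)
    ultimately show False
      using diagonal_ceer_not_reducible[OF _ k_bounded_B_inf[OF assms]] by simp
  qed
  ultimately show ?thesis
    by (simp add: strictly_reducible_def)
qed

end
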